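(* If $A\in\mathbb{Z}^{d\times n}$ is unimodular and $K$ is a field, then the toric ring $K[A^\pm]$ of the centrally symmetric configuration $A^\pm$ of $A$ is normal.
   Context: An integer matrix $A \in \mathbb{Z}^{d\times n}$ of rank $d$ is called unimodular if all nonzero maximal ($d \times d$) minors of $A$ have the same absolute value. For $A \in \mathbb{Z}^{d\times n}$ with columns $\mathbf{a}_1,\ldots,\mathbf{a}_n$, the centrally symmetric configuration $A^\pm \in \mathbb{Z}^{(d+1)\times(2n+1)}$ is the matrix whose columns are $$\begin{bmatrix}\mathbf{0}\\1\end{bmatrix},\ \begin{bmatrix}\mathbf{a}_1\\1\end{bmatrix},\ldots,\begin{bmatrix}\mathbf{a}_n\\1\end{bmatrix},\ \begin{bmatrix}-\mathbf{a}_1\\1\end{bmatrix},\ldots,\begin{bmatrix}-\mathbf{a}_n\\1\end{bmatrix}.$$ For an integer matrix $C\in\mathbb{Z}^{e\times m}$ with columns $\mathbf{c}_1,\ldots,\mathbf{c}_m$ lying on a hyperplane not passing through the origin, the toric ring $K[C]$ is the $K$-subalgebra of the Laurent polynomial ring $K[t_1^{\pm1},\ldots,t_e^{\pm1}]$ generated by $\mathbf{t}^{\mathbf{c}_1},\ldots,\mathbf{t}^{\mathbf{c}_m}$, where $\mathbf{t}^{\mathbf{c}}=t_1^{c_1}\cdots t_e^{c_e}$. The ring $K[C]$ is normal if and only if $\mathbb{Z}_{\ge0}C=\mathbb{Z}C\cap\mathbb{Q}_{\ge0}C$, where $\mathbb{Z}_{\ge 0}C$, $\mathbb{Z}C$,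 $\mathbb{Q}_{\ge 0}C$ are the sets of combinations of the columns of $C$ with coefficients in $\mathbb{Z}_{\ge0}$, $\mathbb{Z}$, $\mathbb{Q}_{\ge0}$ respectively. *)

theory Defs
  imports
    "HOL-Computational_Algebra.Polynomial"
    "HOL-Computational_Algebra.Fraction_Field"
    "HOL-Library.Poly_Mapping"
    "Jordan_Normal_Form.Determinant"
    "Jordan_Normal_Form.DL_Rank"
    "Jordan_Normal_Form.DL_Submatrix"
begin

text \<open>The maximal minors of \<open>A\<close> are indexed by the sets \<open>J\<close> of \<open>dim_row A\<close> columns.\<close>

definition max_minor :: "int mat \<Rightarrow> nat set \<Rightarrow> int" where
  "max_minor A J = det (submatrix A UNIV J)"

definition unimodular :: "int mat \<Rightarrow> bool" where
  "unimodular A \<longleftrightarrow>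
     vec_space.rank (dim_row A) (map_mat rat_of_int A) = dim_row A \<and>
     (\<forall>J J'. J \<subseteq> {..<dim_col A} \<and> card J = dim_row A \<and> max_minor A J \<noteq> 0 \<and>
             J' \<subseteq> {..<dim_col A} \<and> card J' = dim_row A \<and> max_minor A J' \<noteq> 0 \<longrightarrow>
             \<bar>max_minor A J\<bar> = \<bar>max_minor A J'\<bar>)"

text \<open>Rows and columns are counted from 0, so the row of ones has index \<open>dim_row A\<close>.\<close>

definition cs_config :: "int mat \<Rightarrow> int mat" where
  "cs_config A = mat (dim_row A + 1) (2 * dim_col A + 1)
     (\<lambda>(i, j). if i = dim_row A then 1
               else if j = 0 then 0
               else if j \<le> dim_col A then A $$ (i, j - 1)
               else - A $$ (i, j - dim_col A - 1))"

text \<open>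
  An element of \<open>'k laurent\<close> is a finite \<open>'k\<close>-linear combination of monomials in the variables
  \<open>t\<^sub>0, t\<^sub>1, \<dots>\<close> with integer exponents. The Laurent polynomial ring in \<open>e\<close> variables
  is its subring \<open>laurent_ring e\<close>. Working in one type for all \<open>e\<close> lets the number of rows of
  a matrix be a natural number; a toric ring does not depend on the ambient ring
  (see \<open>toric_ring_subset_laurent_ring\<close>).
\<close>

type_synonym 'k laurent = "(nat \<Rightarrow>\<^sub>0 int) \<Rightarrow>\<^sub>0 'k"

definition laurent_ring :: "nat \<Rightarrow> 'k::field laurent set" where
  "laurent_ring e = {f. \<forall>m \<in> Poly_Mapping.keys f. Poly_Mapping.keys m \<subseteq> {..<e}}"

lift_definition exponent :: "int vec \<Rightarrow> nat \<Rightarrow>\<^sub>0 int" is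
  "\<lambda>c i. if i < dim_vec c then c $ i else 0"
  by (rule finite_subset[OF _ finite_lessThan]) (auto split: if_splits)

definition laurent_monom :: "int vec \<Rightarrow> 'k::field laurent" where
  "laurent_monom c = Poly_Mapping.single (exponent c) 1"

definition is_subalgebra :: "'k::field laurent set \<Rightarrow> bool" where
  "is_subalgebra S \<longleftrightarrow>
     (\<forall>a. Poly_Mapping.single 0 a \<in> S) \<and>
     (\<forall>f\<in>S. \<forall>g\<in>S. f + g \<in> S) \<and> (\<forall>f\<in>S. \<forall>g\<in>S. f * g \<in> S)"

definition toric_ring :: "int mat \<Rightarrow> 'k::field laurent set" where
  "toric_ring C = is_subalgebra hull (laurent_monom ` set (cols C))"

lemma is_subalgebra_toric_ring: "is_subalgebra (toric_ring C)"
  unfolding toric_ring_def by (rule hull_in) (auto simp: is_subalgebra_def)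

lemma is_subalgebra_laurent_ring: "is_subalgebra (laurent_ring e)"
  unfolding is_subalgebra_def
proof (intro conjI allI ballI)
  fix f g :: "'a laurent" assume f: "f \<in> laurent_ring e" and g: "g \<in> laurent_ring e"
  show "f + g \<in> laurent_ring e"
    using f g Poly_Mapping.keys_add[of f g] by (auto simp: laurent_ring_def)
  show "f * g \<in> laurent_ring e"
    unfolding laurent_ring_def mem_Collect_eq
  proof
    fix m assume "m \<in> Poly_Mapping.keys (f * g)"
    then obtain a b where m: "m = a + b" and "a \<in> Poly_Mapping.keys f" "b \<in> Poly_Mapping.keys g"
      using Poly_Mapping.keys_mult[of f g] by blast
    then have "Poly_Mapping.keys a \<subseteq> {..<e}" "Poly_Mapping.keys b \<subseteq> {..<e}"
      using f g by (auto simp: laurent_ring_def)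
    then show "Poly_Mapping.keys m \<subseteq> {..<e}" using m Poly_Mapping.keys_add[of a b] by blast
  qed
qed (auto simp: laurent_ring_def)

lemma toric_ring_subset_laurent_ring: "toric_ring C \<subseteq> laurent_ring (dim_row C)"
  unfolding toric_ring_def
proof (intro hull_minimal is_subalgebra_laurent_ring image_subsetI)
  fix c assume "c \<in> set (cols C)"
  then have "dim_vec c = dim_row C" by (auto simp: cols_def)
  then have "Poly_Mapping.keys (exponent c) \<subseteq> {..<dim_row C}"
    by (auto simp: Poly_Mapping.in_keys_iff exponent.rep_eq split: if_splits)
  then show "laurent_monom c \<in> laurent_ring (dim_row C)"
    by (auto simp: laurent_monom_def laurent_ring_def)
qed

definition integral_over :: "'a::idom set \<Rightarrow> 'a \<Rightarrow> bool" where
  "integral_over R x \<longleftrightarrow>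
     (\<exists>p. lead_coeff p = 1 \<and> (\<forall>i. Polynomial.coeff p i \<in> R) \<and> poly p x = 0)"

text \<open>
  A subring \<open>R\<close> of a domain is normal if it is integrally closed in its field of fractions,
  which is \<open>frac_of R\<close> as a subfield of the field of fractions of the ambient domain.
\<close>

definition frac_of :: "'a::idom set \<Rightarrow> 'a fract set" where
  "frac_of R = {Fract a b | a b. a \<in> R \<and> b \<in> R \<and> b \<noteq> 0}"

definition normal_ring :: "'a::idom set \<Rightarrow> bool" where
  "normal_ring R \<longleftrightarrow>
     (\<forall>x \<in> frac_of R. integral_over ((\<lambda>a. Fract a 1) ` R) x \<longrightarrow> x \<in> (\<lambda>a. Fract a 1) ` R)"

end

theory Submission
  imports Defs
begin

text \<open>
  The toric ring of \<open>cs_config A\<close> is spanned by the monomials whose exponents lie in the semigroup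
  \<open>S\<close> of all \<open>(A x, h)\<close> with \<open>x\<close> integral and \<open>l1\<close>-norm of \<open>x\<close> at most \<open>h\<close> (\<open>cs_exponents\<close>,
  \<open>toric_ring_cs_config\<close>). Two ideas give its normality.

  The first is combinatorial. If \<open>A\<close> is unimodular and an integral vector \<open>A z\<close> has a rational preimage
  under \<open>A\<close> with \<open>l1\<close>-norm at most \<open>h\<close>, then it has an integral one
  (\<open>unimodular_l1_rounding\<close>): the norm does not increase on the way to a preimage supported on
  linearly independent columns, and such a preimage is integral by Cramer's rule, since all nonzero
  maximal minors agree up to sign. Consequently \<open>S\<close> is closed in a strong sense: if \<open>m\<close> is a
  difference of elements of \<open>S\<close>, and \<open>s + k m\<close> is in \<open>S\<close> for some \<open>s\<close> in \<open>S\<close> and all natural numbers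
  \<open>k\<close>, then \<open>m\<close> is in \<open>S\<close> (\<open>cs_exponents_almost_integrally_closed\<close>).

  The second transfers this to the ring. If \<open>a / b\<close> is integral over the ring, there is a nonzero
  \<open>g\<close> such that \<open>g (a / b) ^ k\<close> is in the ring for all \<open>k\<close> (\<open>integral_over_almost_integral\<close>). For a
  monomial order, the leading exponents of these elements show that \<open>lead a - lead b\<close> satisfies the
  closure condition, hence is in \<open>S\<close>. Polynomial division of \<open>a\<close> by \<open>b\<close> therefore never leaves the
  ring, and it ends because the order compares the last coordinate \<open>h\<close> first and \<open>S\<close> has finitely
  many elements below each bound for \<open>h\<close> (\<open>almost_integral_divides\<close>). So \<open>b\<close> divides \<open>a\<close> in the ring.
\<close>

section \<open>Division in rings spanned by monomials\<close>

text \<open>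
  A monomial order is given by an additive embedding \<open>\<kappa>\<close> of the exponents into an ordered group, so
  that the order in use need not be the one that the type of exponents carries.
\<close>

locale monomial_order =
  fixes \<kappa> :: "'g::ab_group_add \<Rightarrow> 'o::linordered_ab_group_add"
  assumes inj: "inj \<kappa>" and kappa_add: "\<kappa> (a + b) = \<kappa> a + \<kappa> b"
begin

lemma kappa_diff: "\<kappa> (a - b) = \<kappa> a - \<kappa> b"
  using kappa_add[of "a - b" b] by (simp add: algebra_simps)

definition lead :: "('g \<Rightarrow>\<^sub>0 'k::zero) \<Rightarrow> 'g" where
  "lead f = inv_into (Poly_Mapping.keys f) \<kappa> (Max (\<kappa> ` Poly_Mapping.keys f))"

lemma kappa_lead: "f \<noteq> 0 \<Longrightarrow> \<kappa> (lead f) = Max (\<kappa> ` Poly_Mapping.keys f)"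
  unfolding lead_def by (intro f_inv_into_f Max_in) auto

lemma lead_in_keys: "f \<noteq> 0 \<Longrightarrow> lead f \<in> Poly_Mapping.keys f"
  unfolding lead_def by (intro inv_into_into Max_in) auto

lemma le_lead: "m \<in> Poly_Mapping.keys f \<Longrightarrow> \<kappa> m \<le> \<kappa> (lead f)"
  by (subst kappa_lead) (auto intro: Max_ge)

lemma lead_eqI:
  assumes "m \<in> Poly_Mapping.keys f" and "\<And>m'. m' \<in> Poly_Mapping.keys f \<Longrightarrow> \<kappa> m' \<le> \<kappa> m"
  shows "lead f = m"
proof -
  have "f \<noteq> 0" using assms(1) by auto
  then show ?thesis
    using assms le_lead[OF assms(1)] lead_in_keys[of f] injD[OF inj] by (metis order_antisym)
qed

text \<open>
  The exponent \<open>lead f + lead g\<close> arises in the product in exactly one way, because any other pair of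
  exponents of \<open>f\<close> and \<open>g\<close> has a strictly smaller sum. Leading terms therefore never cancel.
\<close>

lemma lookup_mult_lead:
  fixes f g :: "'g \<Rightarrow>\<^sub>0 'k::idom"
  shows "Poly_Mapping.lookup (f * g) (lead f + lead g)
    = Poly_Mapping.lookup f (lead f) * Poly_Mapping.lookup g (lead g)"
proof -
  let ?k = "lead f + lead g"
  have "Poly_Mapping.lookup (f * g) ?k
      = (\<Sum>l. Poly_Mapping.lookup f l * (\<Sum>q. Poly_Mapping.lookup g q when ?k = l + q))"
    by (rule lookup_mult)
  also have "\<dots> = (\<Sum>l. Poly_Mapping.lookup f l * Poly_Mapping.lookup g (?k - l))"
  proof (intro Sum_any.cong arg_cong2[where f = "(*)"] refl)
    fix l
    have "(?k = l + q) = (q = ?k - l)" for q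
      by (auto simp: algebra_simps)
    then show "(\<Sum>q. Poly_Mapping.lookup g q when ?k = l + q) = Poly_Mapping.lookup g (?k - l)"
      by simp
  qed
  also have "\<dots> = Sum_any (\<lambda>l. (Poly_Mapping.lookup f l * Poly_Mapping.lookup g (?k - l)) when l = lead f)"
  proof (rule Sum_any.cong)
    fix l
    have "l = lead f" if "l \<in> Poly_Mapping.keys f" "?k - l \<in> Poly_Mapping.keys g"
      using le_lead[OF that(1)] le_lead[OF that(2)] injD[OF inj] by (simp add: kappa_diff kappa_add)
    then show "Poly_Mapping.lookup f l * Poly_Mapping.lookup g (?k - l)
        = (Poly_Mapping.lookup f l * Poly_Mapping.lookup g (?k - l) when l = lead f)"
      by (auto simp: when_def in_keys_iff)
  qed
  finally show ?thesis by simp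
qed

lemma lead_mult:
  fixes f g :: "'g \<Rightarrow>\<^sub>0 'k::idom"
  assumes "f \<noteq> 0" and "g \<noteq> 0"
  shows "f * g \<noteq> 0" and "lead (f * g) = lead f + lead g"
proof -
  have in_keys: "lead f + lead g \<in> Poly_Mapping.keys (f * g)"
    using lead_in_keys[OF assms(1)] lead_in_keys[OF assms(2)] by (simp add: in_keys_iff lookup_mult_lead)
  then show "f * g \<noteq> 0" by auto
  have "\<kappa> m \<le> \<kappa> (lead f + lead g)" if m: "m \<in> Poly_Mapping.keys (f * g)" for m
  proof -
    obtain p q where "m = p + q" "p \<in> Poly_Mapping.keys f" "q \<in> Poly_Mapping.keys g"
      using m keys_mult[of f g] by blast
    then show ?thesis using le_lead[of p f] le_lead[of q g] by (simp add: kappa_add add_mono)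
  qed
  with in_keys show "lead (f * g) = lead f + lead g" by (rule lead_eqI)
qed

lemma lead_power:
  fixes f :: "'g \<Rightarrow>\<^sub>0 'k::idom"
  assumes "f \<noteq> 0"
  shows "f ^ k \<noteq> 0 \<and> lead (f ^ k) = (\<Sum>i<k. lead f)"
proof (induction k)
  case 0
  have "lead (1 :: 'g \<Rightarrow>\<^sub>0 'k) = 0" by (rule lead_eqI) auto
  then show ?case by simp
next
  case (Suc k)
  then show ?case using lead_mult[of f "f ^ k"] assms by simp
qed

end

definition supported_on :: "'g set \<Rightarrow> ('g \<Rightarrow>\<^sub>0 'k::zero) set" where
  "supported_on S = {f. Poly_Mapping.keys f \<subseteq> S}"

lemma supported_on_diff:
  fixes f g :: "'g \<Rightarrow>\<^sub>0 'k::ab_group_add"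
  assumes "f \<in> supported_on S" and "g \<in> supported_on S"
  shows "f - g \<in> supported_on S"
  using assms keys_diff[of f g] unfolding supported_on_def by blast

lemma supported_on_mult:
  fixes f g :: "'g::monoid_add \<Rightarrow>\<^sub>0 'k::semiring_0"
  assumes "\<And>s t. s \<in> S \<Longrightarrow> t \<in> S \<Longrightarrow> s + t \<in> S"
    and "f \<in> supported_on S" and "g \<in> supported_on S"
  shows "f * g \<in> supported_on S"
  using assms keys_mult[of f g] unfolding supported_on_def by blast

context monomial_order
begin

text \<open>
  The hypothesis on \<open>a\<close> says that \<open>a / b\<close> is almost integral over the ring: all powers of
  \<open>a / b\<close> have the common denominator \<open>g\<close>. Comparing leading exponents in \<open>g * a ^ k = r * b ^ k\<close>
  shows that \<open>lead g + k (lead a - lead b)\<close> is in \<open>S\<close> for all \<open>k\<close>, so the hypothesis on \<open>S\<close>,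
  which is the same closure property one level down, puts \<open>m = lead a - lead b\<close> into \<open>S\<close>. Hence one
  step of polynomial division, subtracting a multiple of the monomial \<open>m\<close> from \<open>a / b\<close>, stays inside
  the ring, preserves the denominator \<open>g\<close>, and lowers the leading exponent. Since only finitely many
  elements of \<open>S\<close> lie below \<open>m\<close>, the division ends, and it can only end with remainder \<open>0\<close>.
\<close>

lemma almost_integral_divides:
  fixes a b g :: "'g \<Rightarrow>\<^sub>0 'k::field"
  assumes S_add: "\<And>s t. s \<in> S \<Longrightarrow> t \<in> S \<Longrightarrow> s + t \<in> S"
    and S_fin: "\<And>m. finite {s \<in> S. \<kappa> s \<le> \<kappa> m}"
    and S_closed: "\<And>m s p q. m = p - q \<Longrightarrow> p \<in> S \<Longrightarrow> q \<in> S \<Longrightarrow> s \<in> S \<Longrightarrow>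
      (\<And>k::nat. s + (\<Sum>i<k. m) \<in> S) \<Longrightarrow> m \<in> S"
    and b: "b \<in> supported_on S" "b \<noteq> 0" and g: "g \<in> supported_on S" "g \<noteq> 0"
    and a: "a \<in> supported_on S" "\<And>k. \<exists>r \<in> supported_on S. g * a ^ k = r * b ^ k"
  shows "\<exists>q \<in> supported_on S. a = q * b"
  using a
proof (induction "card {s \<in> S. \<kappa> s \<le> \<kappa> (lead a - lead b)}" arbitrary: a rule: less_induct)
  case less
  show ?case
  proof (cases "a = 0")
    case True
    then show ?thesis by (intro bexI[of _ 0]) (auto simp: supported_on_def)
  next
    case False
    define m where "m = lead a - lead b"
    have lead_S: "lead f \<in> S" if "f \<in> supported_on S" "f \<noteq> 0" for f :: "'g \<Rightarrow>\<^sub>0 'k"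
      using that lead_in_keys[of f] by (auto simp: supported_on_def)
    have m: "m \<in> S"
      unfolding m_def
    proof (rule S_closed[OF refl])
      show "lead a \<in> S" "lead b \<in> S" "lead g \<in> S" using lead_S less.prems(1) False b g by auto
      fix k
      obtain r where r: "r \<in> supported_on S" "g * a ^ k = r * b ^ k" using less.prems(2) by blast
      have "g * a ^ k \<noteq> 0" using lead_mult(1) lead_power False g by blast
      then have "r \<noteq> 0" using r by auto
      have "lead g + (\<Sum>i<k. lead a) = lead r + (\<Sum>i<k. lead b)"
        using lead_mult(2)[of g "a ^ k"] lead_mult(2)[of r "b ^ k"] lead_power[of a k]
          lead_power[of b k] r False b g \<open>r \<noteq> 0\<close> by metis
      then have "lead g + (\<Sum>i<k. lead a - lead b) = lead r"
        unfolding sum_subtractf by (simp add: algebra_simps)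
      then show "lead g + (\<Sum>i<k. lead a - lead b) \<in> S" using lead_S r \<open>r \<noteq> 0\<close> by metis
    qed
    define c where "c = Poly_Mapping.lookup a (lead a) / Poly_Mapping.lookup b (lead b)"
    define t where "t = Poly_Mapping.single m c"
    define a' where "a' = a - t * b"
    have t: "t \<in> supported_on S" using m by (auto simp: t_def supported_on_def)
    have nz: "Poly_Mapping.lookup a (lead a) \<noteq> 0" "Poly_Mapping.lookup b (lead b) \<noteq> 0"
      using lead_in_keys False b by (auto simp: in_keys_iff)
    then have "c \<noteq> 0" by (simp add: c_def)
    have "Poly_Mapping.lookup t m \<noteq> 0" using \<open>c \<noteq> 0\<close> by (simp add: t_def)
    then have "t \<noteq> 0" by auto
    have lead_t: "lead t = m" by (rule lead_eqI) (use \<open>c \<noteq> 0\<close> in \<open>auto simp: t_def\<close>)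
    have lead_tb: "lead (t * b) = lead a"
      using lead_mult(2)[OF \<open>t \<noteq> 0\<close> b(2)] by (simp add: lead_t m_def)
    have "Poly_Mapping.lookup (t * b) (lead a) = c * Poly_Mapping.lookup b (lead b)"
      using lookup_mult_lead[of t b] unfolding lead_t by (simp add: m_def t_def)
    then have cancel: "Poly_Mapping.lookup a' (lead a) = 0"
      using nz by (simp add: a'_def c_def lookup_minus)
    have a'_S: "a' \<in> supported_on S"
      unfolding a'_def by (intro supported_on_diff supported_on_mult S_add less.prems t b)
    \<comment> \<open>The powers of \<open>a' / b = a / b - t\<close> have the denominator \<open>g\<close> as well. Mixed powers of \<open>a'\<close> and \<open>a\<close>
      make the induction on \<open>k\<close> work without the binomial theorem.\<close>
    have "\<exists>r \<in> supported_on S. g * (a' ^ k * a ^ j) = r * b ^ (k + j)" for k j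
    proof (induction k arbitrary: j)
      case 0
      show ?case using less.prems(2)[of j] by simp
    next
      case (Suc k)
      obtain r1 r2 where r: "r1 \<in> supported_on S" "g * (a' ^ k * a ^ Suc j) = r1 * b ^ (k + Suc j)"
        "r2 \<in> supported_on S" "g * (a' ^ k * a ^ j) = r2 * b ^ (k + j)"
        using Suc[of "Suc j"] Suc[of j] by blast
      have "g * (a' ^ Suc k * a ^ j) = g * (a' ^ k * a ^ Suc j) - t * b * (g * (a' ^ k * a ^ j))"
        by (simp add: a'_def algebra_simps)
      also have "\<dots> = (r1 - t * r2) * b ^ (Suc k + j)"
        unfolding r by (simp add: algebra_simps)
      finally show ?case
        using supported_on_diff supported_on_mult S_add r t by blast
    qed
    from this[of _ 0] have a'_int: "\<exists>r \<in> supported_on S. g * a' ^ k = r * b ^ k" for k by simp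
    have "\<exists>q \<in> supported_on S. a' = q * b"
    proof (cases "a' = 0")
      case True
      then show ?thesis by (intro bexI[of _ 0]) (auto simp: supported_on_def)
    next
      case a'_nz: False
      have "lead a' \<in> Poly_Mapping.keys a'" by (rule lead_in_keys[OF a'_nz])
      moreover from this have "\<kappa> (lead a') \<le> \<kappa> (lead a)"
        using keys_diff[of a "t * b"] le_lead[of _ a] le_lead[of _ "t * b"]
        unfolding lead_tb a'_def by blast
      moreover have "lead a' \<noteq> lead a" using cancel calculation(1) by (auto simp: in_keys_iff)
      ultimately have less': "\<kappa> (lead a' - lead b) < \<kappa> m"
        using injD[OF inj] unfolding m_def kappa_diff by (simp add: order_less_le) blast
      have "m \<in> {s \<in> S. \<kappa> s \<le> \<kappa> m} - {s \<in> S. \<kappa> s \<le> \<kappa> (lead a' - lead b)}"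
        using m less' by auto
      moreover have "{s \<in> S. \<kappa> s \<le> \<kappa> (lead a' - lead b)} \<subseteq> {s \<in> S. \<kappa> s \<le> \<kappa> m}"
        using less' by auto
      ultimately have "card {s \<in> S. \<kappa> s \<le> \<kappa> (lead a' - lead b)} < card {s \<in> S. \<kappa> s \<le> \<kappa> m}"
        by (intro psubset_card_mono S_fin) blast
      then show ?thesis unfolding m_def by (rule less.hyps[OF _ a'_S a'_int])
    qed
    then obtain q where "q \<in> supported_on S" "a' = q * b" by blast
    moreover from this have "a = (q + t) * b" by (simp add: a'_def algebra_simps)
    moreover have "q + t \<in> supported_on S"
      using calculation(1) t keys_add[of q t] by (auto simp: supported_on_def)
    ultimately show ?thesis by blast
  qed
qed

end

text \<open>
  If \<open>x = a / b\<close> is a root of a monic polynomial of degree \<open>N\<close>, every power of \<open>x\<close> is a combination of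
  \<open>1, x, \<dots>, x ^ (N - 1)\<close>, and \<open>b ^ N\<close> clears the denominators of all of these. The conclusion is
  stated without fractions, as \<open>almost_integral_divides\<close> needs it.
\<close>

lemma integral_over_almost_integral:
  fixes a b :: "'a::idom"
  assumes R_add: "\<And>x y. x \<in> R \<Longrightarrow> y \<in> R \<Longrightarrow> x + y \<in> R"
    and R_mult: "\<And>x y. x \<in> R \<Longrightarrow> y \<in> R \<Longrightarrow> x * y \<in> R"
    and R_uminus: "\<And>x. x \<in> R \<Longrightarrow> - x \<in> R"
    and R_01: "0 \<in> R" "1 \<in> R"
    and ab: "a \<in> R" "b \<in> R" "b \<noteq> 0"
    and int: "integral_over ((\<lambda>a. Fract a 1) ` R) (Fract a b)"
  shows "\<exists>N. \<forall>k. \<exists>r\<in>R. b ^ N * a ^ k = r * b ^ k"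
proof -
  let ?\<iota> = "\<lambda>a::'a. Fract a 1" and ?x = "Fract a b"
  have \<iota>_add: "?\<iota> (u + v) = ?\<iota> u + ?\<iota> v" and \<iota>_mult: "?\<iota> (u * v) = ?\<iota> u * ?\<iota> v"
    and \<iota>_uminus: "?\<iota> (- u) = - ?\<iota> u" for u v by simp_all
  have \<iota>_power: "?\<iota> (u ^ k) = ?\<iota> u ^ k" for u k
    by (induction k) (simp_all only: power_0 power_Suc \<iota>_mult One_fract_def)
  have \<iota>_sum: "(\<Sum>i\<in>I. y i) \<in> ?\<iota> ` R" if "\<And>i. i \<in> I \<Longrightarrow> y i \<in> ?\<iota> ` R" for I :: "nat set" and y
    using that
  proof (induction I rule: infinite_finite_induct)
    case (insert i I)
    then have "y i \<in> ?\<iota> ` R" "(\<Sum>i\<in>I. y i) \<in> ?\<iota> ` R" by simp_all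
    then obtain u v where "u \<in> R" "v \<in> R" "y i = ?\<iota> u" "(\<Sum>i\<in>I. y i) = ?\<iota> v" by blast
    then have "(\<Sum>i\<in>insert i I. y i) = ?\<iota> (u + v)" using insert by simp
    then show ?case using R_add \<open>u \<in> R\<close> \<open>v \<in> R\<close> by blast
  qed (use R_01 in \<open>auto simp: Zero_fract_def\<close>)
  have \<iota>_multR: "y * z \<in> ?\<iota> ` R" if "y \<in> ?\<iota> ` R" "z \<in> ?\<iota> ` R" for y z
    using that R_mult by (auto simp: image_iff)
  have R_power: "u ^ k \<in> R" if "u \<in> R" for u k
    using that R_01 R_mult by (induction k) auto
  have bx: "?\<iota> b * ?x = ?\<iota> a" using ab(3) by (simp add: eq_fract)
  obtain p where p: "lead_coeff p = 1" "\<And>i. Polynomial.coeff p i \<in> ?\<iota> ` R" "poly p ?x = 0"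
    using int by (auto simp: integral_over_def)
  define N where "N = degree p"
  have "0 = (\<Sum>i\<le>N. Polynomial.coeff p i * ?x ^ i)"
    using p(3) by (simp add: poly_altdef N_def)
  then have x_N: "?x ^ N = - (\<Sum>i<N. Polynomial.coeff p i * ?x ^ i)"
    using p(1) by (simp add: N_def lessThan_Suc_atMost[symmetric] add_eq_0_iff2)
  \<comment> \<open>The bound \<open>k \<le> N\<close> is where \<open>b ^ N\<close> visibly clears the denominator of \<open>x ^ k\<close>; above \<open>N\<close>, the
    monic equation reduces \<open>x ^ k\<close> to smaller powers.\<close>
  have key: "?\<iota> (b ^ N) * ?x ^ k \<in> ?\<iota> ` R" for k
  proof (induction k rule: less_induct)
    case (less k)
    show ?case
    proof (cases "k \<le> N")
      case True
      then have "?\<iota> (b ^ N) * ?x ^ k = ?\<iota> b ^ (N - k + k) * ?x ^ k"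
        by (simp only: \<iota>_power le_add_diff_inverse2)
      also have "\<dots> = ?\<iota> (b ^ (N - k)) * (?\<iota> b * ?x) ^ k"
        by (simp only: \<iota>_power power_add power_mult_distrib mult.assoc)
      also have "\<dots> = ?\<iota> (b ^ (N - k) * a ^ k)" by (simp only: bx \<iota>_mult \<iota>_power)
      finally show ?thesis using R_mult R_power ab by blast
    next
      case False
      have "?\<iota> (b ^ N) * ?x ^ k = ?\<iota> (b ^ N) * (?x ^ N * ?x ^ (k - N))"
        using False by (simp add: power_add[symmetric])
      also have "\<dots> = - (\<Sum>i<N. Polynomial.coeff p i * (?\<iota> (b ^ N) * ?x ^ (i + (k - N))))"
        unfolding x_N by (simp add: sum_distrib_left sum_distrib_right power_add mult_ac
            del: mult_fract)
      finally have eq: "?\<iota> (b ^ N) * ?x ^ k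
        = - (\<Sum>i<N. Polynomial.coeff p i * (?\<iota> (b ^ N) * ?x ^ (i + (k - N))))" .
      have "(\<Sum>i<N. Polynomial.coeff p i * (?\<iota> (b ^ N) * ?x ^ (i + (k - N)))) \<in> ?\<iota> ` R"
        by (intro \<iota>_sum \<iota>_multR p less) (use False in auto)
      then show ?thesis unfolding eq using R_uminus \<iota>_uminus by (metis (no_types, lifting) image_iff)
    qed
  qed
  have "\<exists>r\<in>R. b ^ N * a ^ k = r * b ^ k" for k
  proof -
    obtain r where r: "r \<in> R" "?\<iota> (b ^ N) * ?x ^ k = ?\<iota> r" using key[of k] by blast
    have "?\<iota> (b ^ N * a ^ k) = ?\<iota> (b ^ N) * (?\<iota> b * ?x) ^ k" by (simp only: bx \<iota>_mult \<iota>_power)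
    also have "\<dots> = ?\<iota> (r * b ^ k)"
      unfolding power_mult_distrib \<iota>_mult \<iota>_power r(2)[unfolded \<iota>_power, symmetric]
      by (simp only: mult_ac)
    finally show ?thesis using r(1) by (auto simp: eq_fract)
  qed
  then show ?thesis by blast
qed

section \<open>Maximal minors of unimodular matrices\<close>

text \<open>
  Columns are selected by an index function rather than by a set: replacing the \<open>j\<close>-th selected column
  is then \<open>f(j := k)\<close>, and determinants need no bookkeeping of signs or of the order of columns.
\<close>

definition select_cols :: "'a mat \<Rightarrow> (nat \<Rightarrow> nat) \<Rightarrow> 'a mat" where
  "select_cols A f = mat (dim_row A) (dim_row A) (\<lambda>(i, j). A $$ (i, f j))"

lemma select_cols_carrier [simp]: "A \<in> carrier_mat d n \<Longrightarrow> select_cols A f \<in> carrier_mat d d"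
  by (simp add: select_cols_def)

lemma det_select_cols_not_inj:
  fixes A :: "int mat"
  assumes A: "A \<in> carrier_mat d n" and "\<not> inj_on f {..<d}"
  shows "det (select_cols A f) = 0"
proof -
  obtain i j where ij: "i < d" "j < d" "i \<noteq> j" "f i = f j"
    using assms(2) by (auto simp: inj_on_def)
  have "col (select_cols A f) i = col (select_cols A f) j"
    using ij A by (auto simp: select_cols_def)
  then show ?thesis
    using det_identical_columns[OF select_cols_carrier[OF A] ij(3,1,2)] by blast
qed

text \<open>
  The submatrix with the columns in \<open>f ` {..<d}\<close> lists them in increasing order, so it differs from
  \<open>select_cols A f\<close> by the permutation that sorts the values of \<open>f\<close>.
\<close>

lemma det_select_cols_inj:
  fixes A :: "int mat"
  assumes A: "A \<in> carrier_mat d n" and f: "f ` {..<d} \<subseteq> {..<n}" "inj_on f {..<d}"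
  shows "\<bar>det (select_cols A f)\<bar> = \<bar>max_minor A (f ` {..<d})\<bar>"
proof -
  define J where "J = f ` {..<d}"
  have J: "finite J" "card J = d" "J \<subseteq> {..<n}"
    using f card_image[OF f(2)] by (auto simp: J_def)
  define p where "p j = (if j < d then card {a \<in> J. a < f j} else j)" for j
  have pick_p: "pick J (p j) = f j" if "j < d" for j
    using that by (simp add: p_def J_def pick_card_in_set)
  have p_less: "p j < d" if "j < d" for j
  proof -
    have "{a \<in> J. a < f j} \<subset> J" using that by (auto simp: J_def)
    then show ?thesis using psubset_card_mono[OF J(1)] J(2) that by (auto simp: p_def)
  qed
  have "inj_on p {0..<d}"
  proof (rule inj_onI)
    fix i j assume "i \<in> {0..<d}" "j \<in> {0..<d}" "p i = p j"
    then have "f i = f j" using pick_p[of i] pick_p[of j] by simp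
    then show "i = j" using inj_onD[OF f(2)] \<open>i \<in> _\<close> \<open>j \<in> _\<close> by simp
  qed
  moreover have "p ` {0..<d} \<subseteq> {0..<d}" using p_less by auto
  ultimately have "bij_betw p {0..<d} {0..<d}"
    by (simp add: bij_betw_def endo_inj_surj)
  then have perm: "p permutes {0..<d}"
    by (rule bij_imp_permutes) (simp add: p_def)
  define M where "M = submatrix A UNIV J"
  have J_eq: "{j. j < n \<and> j \<in> J} = J" using J(3) by auto
  have M: "M \<in> carrier_mat d d"
    by (intro carrier_matI)
      (simp_all add: M_def dim_submatrix carrier_matD[OF A] J_eq J(2))
  have M_index: "M $$ (i, p j) = A $$ (i, f j)" if "i < d" "j < d" for i j
  proof -
    have "card {a \<in> UNIV. a < i} = i" by simp
    moreover have "f j \<in> J" "f j < n" using f(1) that by (auto simp: J_def)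
    ultimately show ?thesis
      using submatrix_index_card[of i A "f j" UNIV J] that carrier_matD[OF A]
      by (simp add: M_def p_def)
  qed
  have "transpose_mat (select_cols A f) = mat d d (\<lambda>(i, j). transpose_mat M $$ (p i, j))"
    using A M M_index p_less by (intro eq_matI) (auto simp: select_cols_def)
  then have "det (transpose_mat (select_cols A f)) = signof p * det (transpose_mat M)"
    using det_permute_rows[OF transpose_carrier_mat[THEN iffD2, OF M] perm] by simp
  then have "det (select_cols A f) = signof p * det M"
    using det_transpose[OF M] det_transpose[OF select_cols_carrier[OF A]] by simp
  then show ?thesis by (simp add: max_minor_def M_def J_def abs_mult sign_def)
qed

text \<open>
  This is Laplace expansion along column \<open>i\<close> of \<open>select_cols A (f(i := k))\<close>, whose cofactors in that
  column do not see the replaced entries.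
\<close>

lemma cofactor_select_cols:
  fixes A :: "int mat"
  assumes A: "A \<in> carrier_mat d n" and i: "i < d"
  shows "(\<Sum>r<d. cofactor (select_cols A f) r i * A $$ (r, k)) = det (select_cols A (f(i := k)))"
proof -
  let ?N = "select_cols A (f(i := k))"
  have "det ?N = (\<Sum>r<d. ?N $$ (r, i) * cofactor ?N r i)"
    by (rule laplace_expansion_column[OF select_cols_carrier[OF A] i])
  also have "\<dots> = (\<Sum>r<d. cofactor (select_cols A f) r i * A $$ (r, k))"
  proof (rule sum.cong[OF refl])
    fix r assume "r \<in> {..<d}"
    moreover have "mat_delete ?N r i = mat_delete (select_cols A f) r i"
      using A by (intro eq_matI) (auto simp: mat_delete_def select_cols_def)
    ultimately show "?N $$ (r, i) * cofactor ?N r i = cofactor (select_cols A f) r i * A $$ (r, k)"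
      using A i by (simp add: cofactor_def select_cols_def)
  qed
  finally show ?thesis by simp
qed

text \<open>
  Cramer's rule without division: for a basis of columns, the coordinates of the \<open>k\<close>-th column are the
  quotients \<open>det (select_cols A (f(j := k))) / det (select_cols A f)\<close>.
\<close>

lemma select_cols_cramer:
  fixes A :: "int mat"
  assumes A: "A \<in> carrier_mat d n" and r: "r < d"
  shows "(\<Sum>j<d. A $$ (r, f j) * det (select_cols A (f(j := k)))) = det (select_cols A f) * A $$ (r, k)"
proof -
  let ?M = "select_cols A f"
  have M: "?M \<in> carrier_mat d d" using A by simp
  have orth: "(\<Sum>j<d. A $$ (r, f j) * cofactor ?M i j) = (if i = r then det ?M else 0)" if "i < d" for i
  proof -
    have "(\<Sum>j<d. A $$ (r, f j) * cofactor ?M i j) = (?M * adj_mat ?M) $$ (r, i)"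
      using that r A M by (auto simp: times_mat_def scalar_prod_def adj_mat_def select_cols_def
          lessThan_atLeast0 intro!: sum.cong)
    also have "\<dots> = (if i = r then det ?M else 0)"
      unfolding adj_mat(2)[OF M] using that r by auto
    finally show ?thesis .
  qed
  have "(\<Sum>j<d. A $$ (r, f j) * det (select_cols A (f(j := k))))
      = (\<Sum>j<d. \<Sum>i<d. A $$ (r, f j) * cofactor ?M i j * A $$ (i, k))"
    by (intro sum.cong refl) (simp add: cofactor_select_cols[OF A, symmetric] sum_distrib_left mult.assoc)
  also have "\<dots> = (\<Sum>i<d. (\<Sum>j<d. A $$ (r, f j) * cofactor ?M i j) * A $$ (i, k))"
    by (subst sum.swap) (simp add: sum_distrib_right)
  also have "\<dots> = (\<Sum>i<d. if i = r then det ?M * A $$ (r, k) else 0)"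
    by (intro sum.cong refl) (simp add: orth)
  finally show ?thesis using r by simp
qed

lemma full_rank_select_cols:
  fixes A :: "int mat"
  assumes A: "A \<in> carrier_mat d n" and rank: "vec_space.rank d (map_mat rat_of_int A) = d"
  obtains f where "f ` {..<d} \<subseteq> {..<n}" and "det (select_cols A f) \<noteq> 0"
proof -
  interpret vec_space "TYPE(rat)" d .
  let ?B = "map_mat rat_of_int A"
  have B: "?B \<in> carrier_mat d n" using A by simp
  have "\<exists>S. maximal S (\<lambda>T. T \<subseteq> set (cols ?B) \<and> lin_indpt T)"
    using maximal_exists_superset[of "set (cols ?B)" "\<lambda>T. T \<subseteq> set (cols ?B) \<and> lin_indpt T" "{}"]
    by (auto simp: lin_dep_def)
  then obtain S where S: "maximal S (\<lambda>T. T \<subseteq> set (cols ?B) \<and> lin_indpt T)" by blast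
  then have S': "S \<subseteq> set (cols ?B)" "lin_indpt S" by (auto simp: maximal_def)
  have "card S = d" using rank_card_indpt[OF B S] rank by simp
  moreover have "finite S" using S' finite_subset by blast
  ultimately obtain vs where vs: "set vs = S" "distinct vs" "length vs = d"
    using finite_distinct_list distinct_card by metis
  have vs_carrier: "set vs \<subseteq> carrier_vec d"
    using S'(1) cols_dim[of ?B] carrier_matD(1)[OF B] unfolding vs(1) by simp
  define M where "M = mat_of_cols d vs"
  have M: "M \<in> carrier_mat d d" using vs by (simp add: M_def mat_of_cols_def)
  have "cols M = vs" using vs_carrier by (simp add: M_def)
  then have "rank M = d" using lin_indpt_full_rank[OF M] vs S' by simp
  then have detM: "det M \<noteq> 0" using det_rank_iff[OF M] by simp
  have "\<forall>j<d. \<exists>k<n. vs ! j = col ?B k"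
  proof (intro allI impI)
    fix j assume "j < d"
    then have "vs ! j \<in> set (cols ?B)" using S'(1) vs nth_mem[of j vs] by blast
    then show "\<exists>k<n. vs ! j = col ?B k" using B by (auto simp: cols_def)
  qed
  then obtain f where f: "\<And>j. j < d \<Longrightarrow> f j < n" "\<And>j. j < d \<Longrightarrow> vs ! j = col ?B (f j)" by metis
  have "M = map_mat rat_of_int (select_cols A f)"
  proof (rule eq_matI)
    fix i j assume "i < dim_row (map_mat rat_of_int (select_cols A f))"
      "j < dim_col (map_mat rat_of_int (select_cols A f))"
    then have "i < d" "j < d" using A by (simp_all add: select_cols_def)
    then show "M $$ (i, j) = map_mat rat_of_int (select_cols A f) $$ (i, j)"
      using A f vs by (simp add: M_def mat_of_cols_def select_cols_def)
  qed (use A M in \<open>simp_all add: select_cols_def\<close>)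
  then have "det (select_cols A f) \<noteq> 0" using detM by (simp add: of_int_hom.hom_det)
  then show ?thesis using f by (intro that[of f]) auto
qed

text \<open>
  This is the form in which equality of the minors is used: together with Cramer's rule it says that
  every column is an integral combination of any basis of columns.
\<close>

lemma unimodular_select_cols:
  assumes A: "A \<in> carrier_mat d n" and "unimodular A"
    and f: "f ` {..<d} \<subseteq> {..<n}" "det (select_cols A f) \<noteq> 0" and g: "g ` {..<d} \<subseteq> {..<n}"
  shows "det (select_cols A f) dvd det (select_cols A g)"
proof (cases "det (select_cols A g) = 0")
  case False
  have inj: "inj_on f {..<d}" "inj_on g {..<d}"
    using det_select_cols_not_inj[OF A] f False by blast+
  note minors = det_select_cols_inj[OF A f(1) inj(1)] det_select_cols_inj[OF A g inj(2)]
  have nz: "max_minor A (f ` {..<d}) \<noteq> 0" "max_minor A (g ` {..<d}) \<noteq> 0"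
    using minors f(2) False by linarith+
  have cards: "card (f ` {..<d}) = d" "card (g ` {..<d}) = d"
    using card_image[OF inj(1)] card_image[OF inj(2)] by (simp_all only: card_lessThan)
  have minors_eq: "\<forall>J J'. J \<subseteq> {..<n} \<and> card J = d \<and> max_minor A J \<noteq> 0 \<and>
      J' \<subseteq> {..<n} \<and> card J' = d \<and> max_minor A J' \<noteq> 0 \<longrightarrow> \<bar>max_minor A J\<bar> = \<bar>max_minor A J'\<bar>"
    using conjunct2[OF assms(2)[unfolded unimodular_def carrier_matD[OF A]]] .
  have "\<bar>max_minor A (f ` {..<d})\<bar> = \<bar>max_minor A (g ` {..<d})\<bar>"
  proof (rule minors_eq[THEN spec, THEN spec, THEN mp], intro conjI)
    show "f ` {..<d} \<subseteq> {..<n}" by (rule f(1))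
    show "g ` {..<d} \<subseteq> {..<n}" by (rule g)
  qed (rule nz cards)+
  then have "\<bar>det (select_cols A f)\<bar> = \<bar>det (select_cols A g)\<bar>" using minors by simp
  then show ?thesis by (simp add: abs_eq_iff) auto
qed simp

section \<open>Integral solutions of small norm\<close>

text \<open>
  As long as no coordinate changes sign, the \<open>l1\<close>-norm is linear along the line \<open>x + t * w\<close>, so it does
  not increase in one of the two directions. Moving in that direction must bring some coordinate to
  \<open>0\<close>, as otherwise every coordinate that changes would grow in absolute value; the point where this happens first is the one
  claimed.
\<close>

lemma l1_norm_reduce_support:
  fixes x w :: "'a \<Rightarrow> 'b::linordered_field"
  assumes K: "finite K" and supp: "\<And>k. k \<in> K \<Longrightarrow> w k \<noteq> 0 \<Longrightarrow> x k \<noteq> 0"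
    and w: "\<exists>k\<in>K. w k \<noteq> 0"
  obtains t k where "k \<in> K" and "x k \<noteq> 0" and "x k + t * w k = 0"
    and "(\<Sum>k\<in>K. \<bar>x k + t * w k\<bar>) \<le> (\<Sum>k\<in>K. \<bar>x k\<bar>)"
proof -
  have descent: "\<exists>t k. k \<in> K \<and> x k \<noteq> 0 \<and> x k + t * w k = 0 \<and>
      (\<Sum>k\<in>K. \<bar>x k + t * w k\<bar>) \<le> (\<Sum>k\<in>K. \<bar>x k\<bar>)"
    if supp: "\<And>k. k \<in> K \<Longrightarrow> w k \<noteq> 0 \<Longrightarrow> x k \<noteq> 0" and w: "\<exists>k\<in>K. w k \<noteq> 0"
      and slope: "(\<Sum>k\<in>K. sgn (x k) * w k) \<le> 0" for w
  proof -
    \<comment> \<open>\<open>T\<close> consists of the coordinates that move towards \<open>0\<close>; the first of them arrives at time \<open>t\<close>.\<close>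
    define T where "T = {k \<in> K. sgn (x k) * w k < 0}"
    have "T \<noteq> {}"
    proof
      assume "T = {}"
      then have nonneg: "\<forall>k\<in>K. 0 \<le> sgn (x k) * w k" by (auto simp: T_def not_less)
      then have "(\<Sum>k\<in>K. sgn (x k) * w k) = 0" using slope by (intro antisym sum_nonneg) auto
      then have "\<forall>k\<in>K. sgn (x k) * w k = 0" by (simp add: sum_nonneg_eq_0_iff[OF K] nonneg)
      then show False using w supp by (auto simp: sgn_eq_0_iff)
    qed
    define t where "t = Min ((\<lambda>k. \<bar>x k\<bar> / \<bar>w k\<bar>) ` T)"
    have fin: "finite ((\<lambda>k. \<bar>x k\<bar> / \<bar>w k\<bar>) ` T)" using K by (simp add: T_def)
    have "t \<in> (\<lambda>k. \<bar>x k\<bar> / \<bar>w k\<bar>) ` T"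
      unfolding t_def using \<open>T \<noteq> {}\<close> by (intro Min_in[OF fin]) simp
    then obtain k0 where k0: "k0 \<in> T" "t = \<bar>x k0\<bar> / \<bar>w k0\<bar>" by blast
    have "t \<ge> 0" unfolding k0(2) by simp
    have t_le: "t * \<bar>w k\<bar> \<le> \<bar>x k\<bar>" if "k \<in> T" for k
    proof -
      have "w k \<noteq> 0" using that by (auto simp: T_def)
      moreover have "t \<le> \<bar>x k\<bar> / \<bar>w k\<bar>" unfolding t_def using that fin by (intro Min_le) auto
      ultimately show ?thesis by (simp add: field_simps)
    qed
    have abs_eq: "\<bar>x k + t * w k\<bar> = \<bar>x k\<bar> + t * (sgn (x k) * w k)" if k: "k \<in> K" for k
    proof (cases "k \<in> T")
      case True
      then consider "x k > 0" "w k < 0" | "x k < 0" "w k > 0"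
        by (auto simp: T_def sgn_if mult_less_0_iff split: if_splits)
      then show ?thesis using t_le[OF True] by cases simp_all
    next
      case False
      then have nonneg: "0 \<le> sgn (x k) * w k" using k by (simp add: T_def)
      then have t_sgn: "0 \<le> t * (sgn (x k) * w k)" using \<open>t \<ge> 0\<close> by simp
      consider "w k = 0" | "x k > 0" | "x k < 0" using supp[OF k] by linarith
      then show ?thesis using t_sgn by cases simp_all
    qed
    have "(\<Sum>k\<in>K. \<bar>x k + t * w k\<bar>) = (\<Sum>k\<in>K. \<bar>x k\<bar>) + t * (\<Sum>k\<in>K. sgn (x k) * w k)"
      by (simp add: abs_eq sum.distrib sum_distrib_left)
    also have "\<dots> \<le> (\<Sum>k\<in>K. \<bar>x k\<bar>)"
      using \<open>t \<ge> 0\<close> slope by (simp add: mult_nonneg_nonpos)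
    finally have "(\<Sum>k\<in>K. \<bar>x k + t * w k\<bar>) \<le> (\<Sum>k\<in>K. \<bar>x k\<bar>)" .
    moreover have "k0 \<in> K" "x k0 \<noteq> 0" "w k0 \<noteq> 0" using k0(1) by (auto simp: T_def)
    moreover have "x k0 + t * w k0 = 0"
    proof -
      consider "x k0 > 0" "w k0 < 0" | "x k0 < 0" "w k0 > 0"
        using k0(1) by (auto simp: T_def sgn_if mult_less_0_iff split: if_splits)
      then show ?thesis unfolding k0(2) by cases simp_all
    qed
    ultimately show ?thesis by blast
  qed
  show ?thesis
  proof (cases "(\<Sum>k\<in>K. sgn (x k) * w k) \<le> 0")
    case True
    then show ?thesis using descent[OF supp w] that by blast
  next
    case False
    then have "(\<Sum>k\<in>K. sgn (x k) * (- w k)) \<le> 0" by (simp add: sum_negf)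
    then obtain t k where "k \<in> K" "x k \<noteq> 0" "x k + t * (- w k) = 0"
        "(\<Sum>k\<in>K. \<bar>x k + t * (- w k)\<bar>) \<le> (\<Sum>k\<in>K. \<bar>x k\<bar>)"
      using descent[of "\<lambda>k. - w k"] supp w by auto
    then show ?thesis using that[of k "- t"] by simp
  qed
qed

text \<open>
  Among the rational solutions of \<open>A u = A z\<close> with \<open>l1\<close>-norm at most that of \<open>x\<close>, one with the smallest
  support is supported on linearly independent columns, because a linear relation between columns in
  the support would allow \<open>l1_norm_reduce_support\<close> to shrink it. Such a solution is determined by
  Cramer's rule for a basis that contains its support, and unimodularity makes it integral.

  Independence is used through a basis of columns \<open>f\<close> that hits the support of \<open>u\<close> as often as
  possible. If some column \<open>i\<close> of the support were missing from \<open>f\<close>, it would be a combination of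
  columns of \<open>f\<close>. By maximality none of the columns involved could be exchanged for \<open>i\<close> with profit,
  so they all lie in the support, which gives the forbidden relation.
\<close>

lemma unimodular_l1_rounding:
  fixes A :: "int mat" and x :: "nat \<Rightarrow> rat" and z :: "nat \<Rightarrow> int"
  assumes A: "A \<in> carrier_mat d n" and uni: "unimodular A"
    and x: "\<And>r. r < d \<Longrightarrow> (\<Sum>k<n. of_int (A $$ (r, k)) * x k) = of_int (\<Sum>k<n. A $$ (r, k) * z k)"
  obtains y :: "nat \<Rightarrow> int"
  where "\<forall>r<d. (\<Sum>k<n. A $$ (r, k) * y k) = (\<Sum>k<n. A $$ (r, k) * z k)"
    and "of_int (\<Sum>k<n. \<bar>y k\<bar>) \<le> (\<Sum>k<n. \<bar>x k\<bar>)"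
proof -
  let ?D = "\<lambda>f. det (select_cols A f)"
  define sol where "sol u \<longleftrightarrow>
    (\<forall>r<d. (\<Sum>k<n. of_int (A $$ (r, k)) * u k) = of_int (\<Sum>k<n. A $$ (r, k) * z k)) \<and>
    (\<Sum>k<n. \<bar>u k\<bar>) \<le> (\<Sum>k<n. \<bar>x k\<bar>)" for u :: "nat \<Rightarrow> rat"
  define supp where "supp u = {k \<in> {..<n}. u k \<noteq> 0}" for u :: "nat \<Rightarrow> rat"
  have "sol x" using x by (simp add: sol_def)
  then have "\<exists>u. sol u \<and> (\<forall>u'. sol u' \<longrightarrow> card (supp u) \<le> card (supp u'))"
    using Lattices_Big.ex_has_least_nat[of sol x "\<lambda>u. card (supp u)"] by simp
  then obtain u where u: "sol u" and min: "\<And>u'. sol u' \<Longrightarrow> card (supp u) \<le> card (supp u')"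
    by blast
  define basis where "basis f \<longleftrightarrow> f ` {..<d} \<subseteq> {..<n} \<and> ?D f \<noteq> 0" for f
  define hits where "hits f = {j \<in> {..<d}. u (f j) \<noteq> 0}" for f
  have "vec_space.rank d (map_mat rat_of_int A) = d"
    using uni A by (simp add: unimodular_def)
  then obtain f0 where "basis f0" using full_rank_select_cols[OF A] unfolding basis_def by metis
  moreover have "\<forall>f. basis f \<longrightarrow> card (hits f) < Suc d"
  proof (intro allI impI)
    fix f
    have "card (hits f) \<le> card {..<d}" by (rule card_mono) (auto simp: hits_def)
    then show "card (hits f) < Suc d" by simp
  qed
  ultimately have "\<exists>f. basis f \<and> (\<forall>g. basis g \<longrightarrow> card (hits g) \<le> card (hits f))"
    using Lattices_Big.ex_has_greatest_nat[of basis f0 "\<lambda>f. card (hits f)"] by simp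
  then obtain f where f: "basis f" and max: "\<And>g. basis g \<Longrightarrow> card (hits g) \<le> card (hits f)"
    by blast
  have f_n: "f j < n" if "j < d" for j using f that by (auto simp: basis_def)
  have Df: "?D f \<noteq> 0" using f by (simp add: basis_def)
  then have inj: "inj_on f {..<d}" using det_select_cols_not_inj[OF A] by blast
  have supp_sub: "i \<in> f ` {..<d}" if i: "i < n" "u i \<noteq> 0" for i
  proof (rule ccontr)
    assume not_in: "i \<notin> f ` {..<d}"
    define e where "e j = ?D (f(j := i))" for j
    have hit: "u (f j) \<noteq> 0" if j: "j < d" "e j \<noteq> 0" for j
    proof
      assume zero: "u (f j) = 0"
      have "basis (f(j := i))"
        using f i j by (auto simp: basis_def e_def)
      then have "card (hits (f(j := i))) \<le> card (hits f)" by (rule max)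
      moreover have "hits (f(j := i)) = insert j (hits f)"
        using i j by (auto simp: hits_def)
      moreover have "j \<notin> hits f" "finite (hits f)" using zero by (auto simp: hits_def)
      ultimately show False by simp
    qed
    \<comment> \<open>The relation that expresses column \<open>i\<close> by the columns of \<open>f\<close>, multiplied by \<open>?D f\<close>.\<close>
    define w :: "nat \<Rightarrow> rat" where "w k = (if k = i then of_int (?D f) else 0)
      - (\<Sum>j<d. if f j = k then of_int (e j) else 0)" for k
    have w_orth: "(\<Sum>k<n. of_int (A $$ (r, k)) * w k) = (0 :: rat)" if r: "r < d" for r
    proof -
      have "(\<Sum>k<n. of_int (A $$ (r, k)) * w k)
          = (\<Sum>k<n. if k = i then of_int (A $$ (r, k) * ?D f) else 0)
            - (\<Sum>k<n. \<Sum>j<d. if f j = k then of_int (A $$ (r, k) * e j) else (0 :: rat))"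
        unfolding sum_subtractf[symmetric]
        by (rule sum.cong) (auto simp: w_def right_diff_distrib sum_distrib_left if_distrib cong: if_cong)
      also have "(\<Sum>k<n. \<Sum>j<d. if f j = k then of_int (A $$ (r, k) * e j) else (0 :: rat))
          = (\<Sum>j<d. \<Sum>k<n. if f j = k then of_int (A $$ (r, k) * e j) else 0)"
        by (rule sum.swap)
      also have "\<dots> = (\<Sum>j<d. of_int (A $$ (r, f j) * e j))"
        using f_n by (intro sum.cong refl) simp
      also have "\<dots> = of_int (?D f * A $$ (r, i))"
        unfolding of_int_sum[symmetric] e_def by (subst select_cols_cramer[OF A r]) (rule refl)
      also have "(\<Sum>k<n. if k = i then of_int (A $$ (r, k) * ?D f) else 0) = of_int (A $$ (r, i) * ?D f)"
        using i by simp
      finally show ?thesis by (simp add: mult.commute)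
    qed
    have w_supp: "u k \<noteq> 0" if "w k \<noteq> 0" for k
    proof (cases "k = i")
      case False
      then have "(\<Sum>j<d. if f j = k then of_int (e j) else 0) \<noteq> (0 :: rat)" using that by (simp add: w_def)
      then obtain j where j: "j \<in> {..<d}" "(if f j = k then of_int (e j) else 0) \<noteq> (0 :: rat)"
        by (rule sum.not_neutral_contains_not_neutral)
      then have "f j = k" "e j \<noteq> 0" by (auto split: if_splits)
      then show ?thesis using hit[of j] j(1) by simp
    qed (use i in simp)
    have "(\<Sum>j<d. if f j = i then of_int (e j) else 0) = (0 :: rat)"
      by (rule sum.neutral) (use not_in in auto)
    then have "w i \<noteq> 0" using Df by (simp add: w_def)
    then have w_ex: "\<exists>k\<in>{..<n}. w k \<noteq> 0" using i by blast
    obtain t k where tk: "k \<in> {..<n}" "u k \<noteq> 0" "u k + t * w k = 0"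
        "(\<Sum>k<n. \<bar>u k + t * w k\<bar>) \<le> (\<Sum>k<n. \<bar>u k\<bar>)"
      by (rule l1_norm_reduce_support[OF finite_lessThan w_supp w_ex])
    define u' where "u' k = u k + t * w k" for k
    have "sol u'" unfolding sol_def
    proof (intro conjI allI impI)
      fix r assume "r < d"
      have "(\<Sum>k<n. of_int (A $$ (r, k)) * u' k)
          = (\<Sum>k<n. of_int (A $$ (r, k)) * u k) + t * (\<Sum>k<n. of_int (A $$ (r, k)) * w k)"
        by (simp add: u'_def distrib_left sum.distrib sum_distrib_left mult.left_commute)
      then show "(\<Sum>k<n. of_int (A $$ (r, k)) * u' k) = of_int (\<Sum>k<n. A $$ (r, k) * z k)"
        using w_orth[OF \<open>r < d\<close>] u \<open>r < d\<close> unfolding sol_def by simp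
    next
      show "(\<Sum>k<n. \<bar>u' k\<bar>) \<le> (\<Sum>k<n. \<bar>x k\<bar>)"
        using tk(4) u unfolding sol_def u'_def by linarith
    qed
    then have "card (supp u) \<le> card (supp u')" by (rule min)
    moreover have "supp u' \<subset> supp u"
    proof
      show "supp u' \<subseteq> supp u" using w_supp by (auto simp: supp_def u'_def)
      show "supp u' \<noteq> supp u" using tk by (auto simp: supp_def u'_def)
    qed
    then have "card (supp u') < card (supp u)"
      by (rule psubset_card_mono[rotated]) (simp add: supp_def)
    ultimately show False by simp
  qed
  \<comment> \<open>Multiplying \<open>A u = A z\<close> by the \<open>i\<close>-th column of cofactors isolates \<open>u (f i)\<close> on the left.\<close>
  have u_f: "of_int (?D f) * u (f i) = of_int (\<Sum>k<n. z k * ?D (f(i := k)))" if i: "i < d" for i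
  proof -
    let ?C = "\<lambda>r. cofactor (select_cols A f) r i"
    have Au: "(\<Sum>j<d. of_int (A $$ (r, f j)) * u (f j)) = of_int (\<Sum>k<n. A $$ (r, k) * z k)"
      if r: "r < d" for r
    proof -
      have "(\<Sum>j<d. of_int (A $$ (r, f j)) * u (f j)) = (\<Sum>k\<in>f ` {..<d}. of_int (A $$ (r, k)) * u k)"
        by (simp add: sum.reindex[OF inj])
      also have "\<dots> = (\<Sum>k<n. of_int (A $$ (r, k)) * u k)"
        by (rule sum.mono_neutral_left) (use f_n supp_sub in auto)
      finally show ?thesis using u r by (simp add: sol_def)
    qed
    have col: "(\<Sum>r<d. ?C r * A $$ (r, f j)) = (if j = i then ?D f else 0)" if j: "j < d" for j
    proof -
      have "\<not> inj_on (f(i := f j)) {..<d}" if "j \<noteq> i"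
      proof
        assume "inj_on (f(i := f j)) {..<d}"
        then have "i = j" by (rule inj_onD) (use i j that in simp_all)
        then show False using that by simp
      qed
      then show ?thesis
        using cofactor_select_cols[OF A i, of f "f j"] det_select_cols_not_inj[OF A, of "f(i := f j)"]
        by auto
    qed
    have "of_int (?D f) * u (f i) = (\<Sum>j<d. of_int (\<Sum>r<d. ?C r * A $$ (r, f j)) * u (f j))"
    proof -
      have "(\<Sum>j<d. of_int (\<Sum>r<d. ?C r * A $$ (r, f j)) * u (f j))
          = (\<Sum>j<d. if j = i then of_int (?D f) * u (f j) else 0)"
        by (rule sum.cong) (auto simp: col simp del: of_int_sum)
      then show ?thesis using i by simp
    qed
    also have "\<dots> = (\<Sum>r<d. of_int (?C r) * (\<Sum>j<d. of_int (A $$ (r, f j)) * u (f j)))"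
      unfolding of_int_sum sum_distrib_right sum_distrib_left of_int_mult mult.assoc by (rule sum.swap)
    also have "\<dots> = of_int (\<Sum>r<d. ?C r * (\<Sum>k<n. A $$ (r, k) * z k))"
      unfolding of_int_sum[of _ "{..<d}"] of_int_mult by (intro sum.cong refl) (simp add: Au)
    also have "(\<Sum>r<d. ?C r * (\<Sum>k<n. A $$ (r, k) * z k)) = (\<Sum>k<n. z k * (\<Sum>r<d. ?C r * A $$ (r, k)))"
      unfolding sum_distrib_left by (subst sum.swap) (simp add: mult_ac)
    finally show ?thesis by (simp only: cofactor_select_cols[OF A i])
  qed
  have u_int: "u k \<in> \<int>" if k: "k < n" for k
  proof (cases "u k = 0")
    case False
    then obtain i where i: "i < d" "k = f i" using supp_sub[OF k False] by blast
    have "?D f dvd ?D (f(i := k'))" if "k' < n" for k'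
      using f f_n that by (intro unimodular_select_cols[OF A uni]) (auto simp: basis_def)
    then have "?D f dvd (\<Sum>k<n. z k * ?D (f(i := k)))" by (intro dvd_sum dvd_mult) simp
    then obtain c where "(\<Sum>k<n. z k * ?D (f(i := k))) = ?D f * c" ..
    then have "of_int (?D f) * u (f i) = of_int (?D f) * of_int c"
      using u_f[OF i(1)] by (simp only: of_int_mult)
    then show ?thesis using Df i(2) by simp
  qed simp
  define y where "y k = \<lfloor>u k\<rfloor>" for k
  have y: "of_int (y k) = u k" if "k < n" for k using u_int[OF that] by (simp add: y_def)
  show ?thesis
  proof (rule that, intro allI impI)
    fix r assume "r < d"
    have "rat_of_int (\<Sum>k<n. A $$ (r, k) * y k) = of_int (\<Sum>k<n. A $$ (r, k) * z k)"
      using u \<open>r < d\<close> y by (simp add: sol_def)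
    then show "(\<Sum>k<n. A $$ (r, k) * y k) = (\<Sum>k<n. A $$ (r, k) * z k)" by (simp only: of_int_eq_iff)
  next
    show "of_int (\<Sum>k<n. \<bar>y k\<bar>) \<le> (\<Sum>k<n. \<bar>x k\<bar>)"
      using u y by (simp add: sol_def)
  qed
qed

section \<open>The exponent semigroup of the centrally symmetric configuration\<close>

text \<open>
  A nonnegative combination of the columns of \<open>cs_config A\<close> can be normalised so that no column \<open>a\<close>
  occurs together with \<open>- a\<close>, the zero column taking up what is left of the last coordinate. This turns
  the semigroup of the columns into the integral points \<open>(A x, h)\<close> with \<open>x\<close> integral of \<open>l1\<close>-norm at
  most \<open>h\<close>.
\<close>

definition cs_exponents :: "int mat \<Rightarrow> (nat \<Rightarrow>\<^sub>0 int) set" where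
  "cs_exponents A = {m.
     (\<exists>x. (\<forall>r<dim_row A. Poly_Mapping.lookup m r = (\<Sum>k<dim_col A. A $$ (r, k) * x k)) \<and>
          (\<Sum>k<dim_col A. \<bar>x k\<bar>) \<le> Poly_Mapping.lookup m (dim_row A)) \<and>
     (\<forall>i>dim_row A. Poly_Mapping.lookup m i = 0)}"

lemma cs_exponentsI:
  assumes "A \<in> carrier_mat d n"
    and "\<And>r. r < d \<Longrightarrow> Poly_Mapping.lookup m r = (\<Sum>k<n. A $$ (r, k) * x k)"
    and "(\<Sum>k<n. \<bar>x k\<bar>) \<le> Poly_Mapping.lookup m d"
    and "\<And>i. i > d \<Longrightarrow> Poly_Mapping.lookup m i = 0"
  shows "m \<in> cs_exponents A"
  unfolding cs_exponents_def carrier_matD[OF assms(1)] mem_Collect_eq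
  using assms(2-4) by (intro conjI exI[of _ x] allI impI)

lemma cs_exponentsE:
  assumes "A \<in> carrier_mat d n" and "m \<in> cs_exponents A"
  obtains x where "\<forall>r<d. Poly_Mapping.lookup m r = (\<Sum>k<n. A $$ (r, k) * x k)"
    and "(\<Sum>k<n. \<bar>x k\<bar>) \<le> Poly_Mapping.lookup m d"
    and "\<forall>i>d. Poly_Mapping.lookup m i = 0"
  using assms(2) unfolding cs_exponents_def carrier_matD[OF assms(1)] mem_Collect_eq
  by (elim conjE exE)

lemma zero_in_cs_exponents:
  assumes A: "A \<in> carrier_mat d n"
  shows "0 \<in> cs_exponents A"
  by (rule cs_exponentsI[OF A, where x = "\<lambda>_. 0"]) simp_all

lemma add_in_cs_exponents:
  assumes A: "A \<in> carrier_mat d n" and p: "p \<in> cs_exponents A" and q: "q \<in> cs_exponents A"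
  shows "p + q \<in> cs_exponents A"
proof -
  obtain x where x: "\<forall>r<d. Poly_Mapping.lookup p r = (\<Sum>k<n. A $$ (r, k) * x k)"
    "(\<Sum>k<n. \<bar>x k\<bar>) \<le> Poly_Mapping.lookup p d" "\<forall>i>d. Poly_Mapping.lookup p i = 0"
    by (rule cs_exponentsE[OF A p])
  note x = x(1)[rule_format] x(2) x(3)[rule_format]
  obtain y where y: "\<forall>r<d. Poly_Mapping.lookup q r = (\<Sum>k<n. A $$ (r, k) * y k)"
    "(\<Sum>k<n. \<bar>y k\<bar>) \<le> Poly_Mapping.lookup q d" "\<forall>i>d. Poly_Mapping.lookup q i = 0"
    by (rule cs_exponentsE[OF A q])
  note y = y(1)[rule_format] y(2) y(3)[rule_format]
  show ?thesis
  proof (rule cs_exponentsI[OF A, where x = "\<lambda>k. x k + y k"])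
    have "(\<Sum>k<n. \<bar>x k + y k\<bar>) \<le> (\<Sum>k<n. \<bar>x k\<bar> + \<bar>y k\<bar>)"
      by (rule sum_mono) (rule abs_triangle_ineq)
    then show "(\<Sum>k<n. \<bar>x k + y k\<bar>) \<le> Poly_Mapping.lookup (p + q) d"
      using x(2) y(2) by (simp add: sum.distrib lookup_add)
  qed (simp_all add: x y lookup_add distrib_left sum.distrib)
qed

text \<open>
  Let \<open>w\<close> and \<open>y\<close> be integral witnesses for \<open>s\<close> and \<open>s + N m\<close>. Then \<open>(y - w) / N\<close> is a rational
  witness for \<open>m\<close> except that its \<open>l1\<close>-norm may exceed the bound \<open>h\<close> by \<open>c / N\<close>, where \<open>c\<close> does not
  depend on \<open>N\<close>. Rounding it to an integral witness does not increase the norm, and for \<open>N > c\<close> an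
  integer below \<open>h + 1\<close> is at most \<open>h\<close>.
\<close>

lemma cs_exponents_almost_integrally_closed:
  assumes A: "A \<in> carrier_mat d n" and uni: "unimodular A"
    and m: "m = p - q" and p: "p \<in> cs_exponents A" and q: "q \<in> cs_exponents A"
    and s: "s \<in> cs_exponents A" and multiples: "\<And>N::nat. s + (\<Sum>i<N. m) \<in> cs_exponents A"
  shows "m \<in> cs_exponents A"
proof -
  obtain xp where xp: "\<forall>r<d. Poly_Mapping.lookup p r = (\<Sum>k<n. A $$ (r, k) * xp k)"
    "(\<Sum>k<n. \<bar>xp k\<bar>) \<le> Poly_Mapping.lookup p d" "\<forall>i>d. Poly_Mapping.lookup p i = 0"
    by (rule cs_exponentsE[OF A p])
  note xp = xp(1)[rule_format] xp(2) xp(3)[rule_format]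
  obtain xq where xq: "\<forall>r<d. Poly_Mapping.lookup q r = (\<Sum>k<n. A $$ (r, k) * xq k)"
    "(\<Sum>k<n. \<bar>xq k\<bar>) \<le> Poly_Mapping.lookup q d" "\<forall>i>d. Poly_Mapping.lookup q i = 0"
    by (rule cs_exponentsE[OF A q])
  note xq = xq(1)[rule_format] xq(2) xq(3)[rule_format]
  obtain w where w: "\<forall>r<d. Poly_Mapping.lookup s r = (\<Sum>k<n. A $$ (r, k) * w k)"
    "(\<Sum>k<n. \<bar>w k\<bar>) \<le> Poly_Mapping.lookup s d" "\<forall>i>d. Poly_Mapping.lookup s i = 0"
    by (rule cs_exponentsE[OF A s])
  note w = w(1)[rule_format] w(2) w(3)[rule_format]
  define z where "z k = xp k - xq k" for k
  define h where "h = Poly_Mapping.lookup m d"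
  define c where "c = Poly_Mapping.lookup s d + (\<Sum>k<n. \<bar>w k\<bar>)"
  define N where "N = nat c + 1"
  have "0 \<le> (\<Sum>k<n. \<bar>w k\<bar>)" by (rule sum_nonneg) simp
  then have "c < int N" "N > 0" using w(2) by (simp_all add: N_def c_def)
  have m_z: "Poly_Mapping.lookup m r = (\<Sum>k<n. A $$ (r, k) * z k)" if "r < d" for r
    using that by (simp add: m z_def lookup_minus xp xq right_diff_distrib sum_subtractf)
  have lookup_Nm: "Poly_Mapping.lookup (s + (\<Sum>i<N. m)) r
      = Poly_Mapping.lookup s r + int N * Poly_Mapping.lookup m r" for r
    unfolding lookup_add lookup_sum by simp
  obtain y where y: "\<forall>r<d. Poly_Mapping.lookup (s + (\<Sum>i<N. m)) r = (\<Sum>k<n. A $$ (r, k) * y k)"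
    "(\<Sum>k<n. \<bar>y k\<bar>) \<le> Poly_Mapping.lookup (s + (\<Sum>i<N. m)) d" "\<forall>i>d. Poly_Mapping.lookup (s + (\<Sum>i<N. m)) i = 0"
    by (rule cs_exponentsE[OF A multiples])
  note y = y(1)[rule_format, unfolded lookup_Nm] y(2)[unfolded lookup_Nm]
  define x where "x k = rat_of_int (y k - w k) / of_nat N" for k
  have Ax: "(\<Sum>k<n. of_int (A $$ (r, k)) * x k) = of_int (\<Sum>k<n. A $$ (r, k) * z k)" if r: "r < d" for r
  proof -
    have "(\<Sum>k<n. A $$ (r, k) * (y k - w k)) = int N * (\<Sum>k<n. A $$ (r, k) * z k)"
      using y(1)[OF r] w(1)[OF r] m_z[OF r] by (simp add: right_diff_distrib sum_subtractf)
    then have "rat_of_int (\<Sum>k<n. A $$ (r, k) * (y k - w k)) = of_nat N * of_int (\<Sum>k<n. A $$ (r, k) * z k)"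
      by (simp only: of_int_mult of_int_of_nat_eq)
    moreover have "(\<Sum>k<n. of_int (A $$ (r, k)) * x k)
        = rat_of_int (\<Sum>k<n. A $$ (r, k) * (y k - w k)) / of_nat N"
      by (simp add: x_def sum_divide_distrib)
    ultimately show ?thesis using \<open>N > 0\<close> by simp
  qed
  obtain v where v: "\<forall>r<d. (\<Sum>k<n. A $$ (r, k) * v k) = (\<Sum>k<n. A $$ (r, k) * z k)"
    "of_int (\<Sum>k<n. \<bar>v k\<bar>) \<le> (\<Sum>k<n. \<bar>x k\<bar>)"
    by (rule unimodular_l1_rounding[OF A uni Ax])
  have "(\<Sum>k<n. \<bar>y k - w k\<bar>) \<le> (\<Sum>k<n. \<bar>y k\<bar> + \<bar>w k\<bar>)"
    by (rule sum_mono) (rule abs_triangle_ineq4)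
  also have "\<dots> \<le> c + int N * h"
    using y(2) by (simp add: sum.distrib c_def h_def)
  also have "\<dots> < int N * (h + 1)" using \<open>c < int N\<close> by (simp add: distrib_left)
  finally have "rat_of_int (\<Sum>k<n. \<bar>y k - w k\<bar>) < of_int (int N * (h + 1))" by (simp only: of_int_less_iff)
  moreover have "(\<Sum>k<n. \<bar>x k\<bar>) = rat_of_int (\<Sum>k<n. \<bar>y k - w k\<bar>) / of_nat N"
    by (simp add: x_def abs_divide sum_divide_distrib)
  ultimately have "(\<Sum>k<n. \<bar>x k\<bar>) < of_int (h + 1)"
    using \<open>N > 0\<close> by (simp add: divide_less_eq mult.commute)
  then have "rat_of_int (\<Sum>k<n. \<bar>v k\<bar>) < of_int (h + 1)" using v(2) by (rule order_le_less_trans[rotated])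
  then have "(\<Sum>k<n. \<bar>v k\<bar>) \<le> h" by (simp only: of_int_less_iff)
  then show ?thesis
    using v(1)[rule_format] m_z by (intro cs_exponentsI[OF A, where x = v]) (simp_all add: h_def m lookup_minus xp xq)
qed

text \<open>
  Comparing the images under \<open>weight_first d\<close> lexicographically means comparing the last coordinate
  \<open>d\<close> first. The semigroup has only finitely many elements with a given bound on that coordinate,
  whereas it may have infinite descending chains for the plain lexicographic order. Keeping all other
  coordinates after the copied one makes the map injective.
\<close>

lift_definition weight_first :: "nat \<Rightarrow> (nat \<Rightarrow>\<^sub>0 int) \<Rightarrow> (nat \<Rightarrow>\<^sub>0 int)" is
  "\<lambda>d m i. case i of 0 \<Rightarrow> m d | Suc j \<Rightarrow> m j"
proof -
  fix d and m :: "nat \<Rightarrow> int"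
  assume "finite {i. m i \<noteq> 0}"
  then have "finite (insert 0 (Suc ` {i. m i \<noteq> 0}))" by simp
  then show "finite {i. (case i of 0 \<Rightarrow> m d | Suc j \<Rightarrow> m j) \<noteq> 0}"
  proof (rule finite_subset[rotated], intro subsetI)
    fix i assume "i \<in> {i. (case i of 0 \<Rightarrow> m d | Suc j \<Rightarrow> m j) \<noteq> 0}"
    then show "i \<in> insert 0 (Suc ` {i. m i \<noteq> 0})" by (cases i) simp_all
  qed
qed

interpretation weight_first: monomial_order "weight_first d" for d
proof
  show "inj (weight_first d)"
  proof (rule injI)
    fix m m' assume eq: "weight_first d m = weight_first d m'"
    have "Poly_Mapping.lookup m i = Poly_Mapping.lookup m' i" for i
      using arg_cong[OF eq, of "\<lambda>m. Poly_Mapping.lookup m (Suc i)"] by (simp add: weight_first.rep_eq)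
    then show "m = m'" by (rule poly_mapping_eqI)
  qed
  show "weight_first d (m + m') = weight_first d m + weight_first d m'" for m m'
    by (rule poly_mapping_eqI) (simp add: weight_first.rep_eq lookup_add split: nat.split)
qed

lemma weight_first_le:
  assumes "weight_first d m \<le> weight_first d m'"
  shows "Poly_Mapping.lookup m d \<le> Poly_Mapping.lookup m' d"
proof -
  have "less_fun (Poly_Mapping.lookup (weight_first d m)) (Poly_Mapping.lookup (weight_first d m'))
      \<or> weight_first d m = weight_first d m'"
    using assms by (simp add: less_eq_poly_mapping.rep_eq)
  moreover have "Poly_Mapping.lookup (weight_first d m) 0 = Poly_Mapping.lookup m d" for m
    by (simp add: weight_first.rep_eq)
  ultimately show ?thesis unfolding less_fun_def
    by (metis not_gr_zero order.strict_implies_order order_refl)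
qed

text \<open>
  A bound on the last coordinate bounds the \<open>l1\<close>-norm of \<open>x\<close> and thereby all coordinates of \<open>A x\<close>.
\<close>

lemma finite_cs_exponents_bounded:
  assumes A: "A \<in> carrier_mat d n"
  shows "finite {s \<in> cs_exponents A. Poly_Mapping.lookup s d \<le> h}"
proof -
  define B where "B = (\<Sum>r<d. \<Sum>k<n. \<bar>A $$ (r, k)\<bar>) * h + h"
  define F where "F = {f. \<forall>i. (i \<in> {..d} \<longrightarrow> f i \<in> {- B..B}) \<and> (i \<notin> {..d} \<longrightarrow> f i = (0 :: int))}"
  have "finite F" unfolding F_def by (rule finite_set_of_finite_funs) simp_all
  moreover have "Poly_Mapping.lookup ` {s \<in> cs_exponents A. Poly_Mapping.lookup s d \<le> h} \<subseteq> F"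
  proof (rule image_subsetI)
    fix s assume "s \<in> {s \<in> cs_exponents A. Poly_Mapping.lookup s d \<le> h}"
    then have s: "s \<in> cs_exponents A" "Poly_Mapping.lookup s d \<le> h" by simp_all
    obtain x where x: "\<forall>r<d. Poly_Mapping.lookup s r = (\<Sum>k<n. A $$ (r, k) * x k)"
      "(\<Sum>k<n. \<bar>x k\<bar>) \<le> Poly_Mapping.lookup s d" "\<forall>i>d. Poly_Mapping.lookup s i = 0"
      by (rule cs_exponentsE[OF A s(1)])
    note x = x(1)[rule_format] x(2) x(3)[rule_format]
    have "0 \<le> (\<Sum>k<n. \<bar>x k\<bar>)" by (rule sum_nonneg) simp
    then have h: "0 \<le> Poly_Mapping.lookup s d" "0 \<le> h" using x(2) s(2) by linarith+
    have "0 \<le> (\<Sum>r<d. \<Sum>k<n. \<bar>A $$ (r, k)\<bar>)" by (intro sum_nonneg) simp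
    then have hB: "h \<le> B" using h(2) by (simp add: B_def)
    have x_le: "\<bar>x k\<bar> \<le> h" if "k < n" for k
      using member_le_sum[of k "{..<n}" "\<lambda>k. \<bar>x k\<bar>"] that x(2) s(2) by simp
    have bound: "\<bar>Poly_Mapping.lookup s r\<bar> \<le> B" if r: "r < d" for r
    proof -
      have "\<bar>Poly_Mapping.lookup s r\<bar> \<le> (\<Sum>k<n. \<bar>A $$ (r, k) * x k\<bar>)"
        unfolding x(1)[OF r] by (rule sum_abs)
      also have "\<dots> \<le> (\<Sum>k<n. \<bar>A $$ (r, k)\<bar> * h)"
        by (rule sum_mono) (simp add: abs_mult mult_left_mono x_le)
      also have "\<dots> = (\<Sum>k<n. \<bar>A $$ (r, k)\<bar>) * h" by (simp add: sum_distrib_right)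
      also have "\<dots> \<le> (\<Sum>r<d. \<Sum>k<n. \<bar>A $$ (r, k)\<bar>) * h"
        using r h(2) by (intro mult_right_mono member_le_sum[of r "{..<d}"] sum_nonneg) simp_all
      also have "\<dots> \<le> B" using h(2) by (simp add: B_def)
      finally show ?thesis .
    qed
    have "Poly_Mapping.lookup s i \<in> {- B..B}" if "i \<le> d" for i
    proof (cases "i = d")
      case True
      then show ?thesis using h s(2) hB by simp
    next
      case False
      then show ?thesis using bound[of i] that by (simp add: abs_le_iff)
    qed
    then show "Poly_Mapping.lookup s \<in> F" using x(3) by (simp add: F_def)
  qed
  ultimately have "finite (Poly_Mapping.lookup ` {s \<in> cs_exponents A. Poly_Mapping.lookup s d \<le> h})"
    by (rule finite_subset[rotated])
  then show ?thesis by (rule finite_imageD) (simp add: inj_on_def Poly_Mapping.lookup_inject)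
qed

lemma lookup_exponent_cs_config:
  assumes A: "A \<in> carrier_mat d n" and j: "j < 2 * n + 1"
  shows "Poly_Mapping.lookup (exponent (col (cs_config A) j)) r =
    (if r < d then (if j = 0 then 0 else if j \<le> n then A $$ (r, j - 1) else - A $$ (r, j - n - 1))
     else if r = d then 1 else 0)"
  using j carrier_matD[OF A] by (simp add: exponent.rep_eq cs_config_def)

lemma set_cols_cs_config:
  assumes A: "A \<in> carrier_mat d n"
  shows "set (cols (cs_config A)) = col (cs_config A) ` {..<2 * n + 1}"
proof -
  have "dim_col (cs_config A) = 2 * n + 1" using carrier_matD[OF A] by (simp add: cs_config_def)
  then show ?thesis by (simp only: cols_def set_map set_upt lessThan_atLeast0)
qed

lemma exponent_cs_config_in_cs_exponents:
  assumes A: "A \<in> carrier_mat d n" and j: "j < 2 * n + 1"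
  shows "exponent (col (cs_config A) j) \<in> cs_exponents A"
proof -
  note lookup = lookup_exponent_cs_config[OF A]
  consider "j = 0" | "0 < j" "j \<le> n" | "n < j" by linarith
  then show ?thesis
  proof cases
    case 1
    show ?thesis unfolding 1 by (intro cs_exponentsI[OF A, where x = "\<lambda>_. 0"]) (simp_all add: lookup)
  next
    case 2
    then have "j - 1 < n" by simp
    then show ?thesis using 2
      by (intro cs_exponentsI[OF A, where x = "\<lambda>k. if k = j - 1 then 1 else 0"])
        (simp_all add: lookup[OF j] if_distrib cong: if_cong)
  next
    case 3
    then have "j - n - 1 < n" using j by simp
    then show ?thesis using 3
      by (intro cs_exponentsI[OF A, where x = "\<lambda>k. if k = j - n - 1 then - 1 else 0"])
        (simp_all add: lookup[OF j] if_distrib cong: if_cong)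
  qed
qed

text \<open>
  If \<open>x\<close> has a nonzero coordinate, subtracting the column of \<open>A\<close> with the same sign lowers both the
  norm and the last coordinate by \<open>1\<close>. If \<open>x = 0\<close>, there is slack and the zero column can be
  subtracted.
\<close>

lemma cs_exponents_diff_col:
  assumes A: "A \<in> carrier_mat d n" and m: "m \<in> cs_exponents A" and pos: "Poly_Mapping.lookup m d > 0"
  obtains j where "j < 2 * n + 1" and "m - exponent (col (cs_config A) j) \<in> cs_exponents A"
proof -
  obtain x where x: "\<forall>r<d. Poly_Mapping.lookup m r = (\<Sum>k<n. A $$ (r, k) * x k)"
    "(\<Sum>k<n. \<bar>x k\<bar>) \<le> Poly_Mapping.lookup m d" "\<forall>i>d. Poly_Mapping.lookup m i = 0"
    by (rule cs_exponentsE[OF A m])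
  note x = x(1)[rule_format] x(2) x(3)[rule_format]
  note lookup = lookup_exponent_cs_config[OF A]
  show ?thesis
  proof (cases "\<exists>k<n. x k \<noteq> 0")
    case False
    then have x0: "x k = 0" if "k < n" for k using that by blast
    have "m - exponent (col (cs_config A) 0) \<in> cs_exponents A"
      using x pos by (intro cs_exponentsI[OF A, where x = x]) (simp_all add: lookup lookup_minus x0)
    then show ?thesis by (rule that[rotated]) simp
  next
    case True
    then obtain k where k: "k < n" "x k \<noteq> 0" by blast
    define j where "j = (if x k > 0 then k + 1 else n + k + 1)"
    have j: "j < 2 * n + 1" using k by (simp add: j_def)
    define x' where "x' = x(k := x k - sgn (x k))"
    have col: "Poly_Mapping.lookup (exponent (col (cs_config A) j)) r =
        (if r < d then sgn (x k) * A $$ (r, k) else if r = d then 1 else 0)" for r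
      using k unfolding lookup[OF j] by (simp add: j_def sgn_if)
    have split: "(\<Sum>i<n. g i) = g k + (\<Sum>i\<in>{..<n} - {k}. g i)" for g :: "nat \<Rightarrow> int"
      using k by (intro sum.remove) simp_all
    have rest: "(\<Sum>i\<in>{..<n} - {k}. g i (x' i)) = (\<Sum>i\<in>{..<n} - {k}. g i (x i))" for g :: "nat \<Rightarrow> int \<Rightarrow> int"
      by (rule sum.cong) (simp_all add: x'_def)
    have "m - exponent (col (cs_config A) j) \<in> cs_exponents A"
    proof (rule cs_exponentsI[OF A, where x = x'])
      fix r assume r: "r < d"
      have "(\<Sum>i<n. A $$ (r, i) * x' i) = (\<Sum>i<n. A $$ (r, i) * x i) - sgn (x k) * A $$ (r, k)"
        using rest[of "\<lambda>i y. A $$ (r, i) * y"] unfolding split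
        by (simp add: x'_def algebra_simps)
      then show "Poly_Mapping.lookup (m - exponent (col (cs_config A) j)) r = (\<Sum>i<n. A $$ (r, i) * x' i)"
        using r by (simp add: lookup_minus col x(1))
    next
      have "\<bar>x' k\<bar> = \<bar>x k\<bar> - 1" using k(2) by (simp add: x'_def sgn_if)
      then have "(\<Sum>i<n. \<bar>x' i\<bar>) = (\<Sum>i<n. \<bar>x i\<bar>) - 1"
        using rest[of "\<lambda>i y. \<bar>y\<bar>"] unfolding split by simp
      then show "(\<Sum>i<n. \<bar>x' i\<bar>) \<le> Poly_Mapping.lookup (m - exponent (col (cs_config A) j)) d"
        using x(2) by (simp add: lookup_minus col)
    qed (simp add: lookup_minus col x(3))
    then show ?thesis by (rule that[OF j])
  qed
qed

section \<open>Normality of the toric ring\<close>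

text \<open>
  The inclusion from right to left splits a Laurent polynomial into its terms and each monomial into
  generators, one column at a time by \<open>cs_exponents_diff_col\<close>.
\<close>

lemma toric_ring_cs_config:
  assumes A: "A \<in> carrier_mat d n"
  shows "toric_ring (cs_config A) = (supported_on (cs_exponents A) :: 'k::field laurent set)"
proof (rule equalityI)
  let ?R = "toric_ring (cs_config A) :: 'k laurent set"
  have "is_subalgebra (supported_on (cs_exponents A) :: 'k laurent set)"
    unfolding is_subalgebra_def
  proof (intro conjI allI ballI)
    show "Poly_Mapping.single 0 a \<in> supported_on (cs_exponents A)" for a :: 'k
      using zero_in_cs_exponents[OF A] by (simp add: supported_on_def)
  next
    fix f g :: "'k laurent"
    assume fg: "f \<in> supported_on (cs_exponents A)" "g \<in> supported_on (cs_exponents A)"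
    show "f + g \<in> supported_on (cs_exponents A)"
      using fg keys_add[of f g] unfolding supported_on_def by blast
    show "f * g \<in> supported_on (cs_exponents A)"
      using fg add_in_cs_exponents[OF A] by (rule supported_on_mult[rotated])
  qed
  moreover have "laurent_monom ` set (cols (cs_config A)) \<subseteq> supported_on (cs_exponents A)"
    unfolding set_cols_cs_config[OF A] image_image
    using exponent_cs_config_in_cs_exponents[OF A]
    by (intro image_subsetI) (simp add: laurent_monom_def supported_on_def)
  ultimately show "?R \<subseteq> supported_on (cs_exponents A)"
    unfolding toric_ring_def by (intro hull_minimal)

  have const: "Poly_Mapping.single 0 a \<in> ?R" and add: "f \<in> ?R \<Longrightarrow> g \<in> ?R \<Longrightarrow> f + g \<in> ?R"
    and mult: "f \<in> ?R \<Longrightarrow> g \<in> ?R \<Longrightarrow> f * g \<in> ?R" for a f g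
    using is_subalgebra_toric_ring[of "cs_config A"] unfolding is_subalgebra_def by blast+
  have monom: "Poly_Mapping.single m 1 \<in> ?R" if "m \<in> cs_exponents A" for m
    using that
  proof (induction "nat (Poly_Mapping.lookup m d)" arbitrary: m rule: less_induct)
    case less
    obtain x where x: "\<forall>r<d. Poly_Mapping.lookup m r = (\<Sum>k<n. A $$ (r, k) * x k)"
      "(\<Sum>k<n. \<bar>x k\<bar>) \<le> Poly_Mapping.lookup m d" "\<forall>i>d. Poly_Mapping.lookup m i = 0"
      by (rule cs_exponentsE[OF A less.prems])
    note x = x(1)[rule_format] x(2) x(3)[rule_format]
    have nonneg: "0 \<le> (\<Sum>k<n. \<bar>x k\<bar>)" by (rule sum_nonneg) simp
    show ?case
    proof (cases "Poly_Mapping.lookup m d > 0")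
      case True
      then obtain j where j: "j < 2 * n + 1" "m - exponent (col (cs_config A) j) \<in> cs_exponents A"
        by (rule cs_exponents_diff_col[OF A less.prems])
      let ?e = "exponent (col (cs_config A) j)"
      have "Poly_Mapping.lookup (m - ?e) d = Poly_Mapping.lookup m d - 1"
        by (simp add: lookup_minus lookup_exponent_cs_config[OF A j(1)])
      then have "Poly_Mapping.single (m - ?e) 1 \<in> ?R"
        using True by (intro less.hyps j(2)) simp
      moreover have "Poly_Mapping.single ?e 1 \<in> ?R"
        unfolding toric_ring_def using j(1)
        by (intro hull_inc) (simp add: set_cols_cs_config[OF A] laurent_monom_def)
      ultimately have "Poly_Mapping.single (m - ?e) 1 * Poly_Mapping.single ?e 1 \<in> ?R" by (rule mult)
      then show ?thesis by (simp add: mult_single)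
    next
      case False
      then have "(\<Sum>k<n. \<bar>x k\<bar>) = 0" "Poly_Mapping.lookup m d = 0" using x(2) nonneg by linarith+
      then have x0: "x k = 0" if "k < n" for k using that by (simp add: sum_nonneg_eq_0_iff)
      have "Poly_Mapping.lookup m i = 0" for i
      proof -
        consider "i < d" | "i = d" | "i > d" by linarith
        then show ?thesis
          by cases (simp_all add: x x0 \<open>Poly_Mapping.lookup m d = 0\<close>)
      qed
      then have "m = 0" by (intro poly_mapping_eqI) simp
      then show ?thesis using const[of 1] by simp
    qed
  qed
  show "supported_on (cs_exponents A) \<subseteq> ?R"
  proof
    fix f :: "'k laurent" assume "f \<in> supported_on (cs_exponents A)"
    then show "f \<in> ?R"
    proof (induction "card (Poly_Mapping.keys f)" arbitrary: f)
      case 0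
      then have "f = 0" by simp
      then show ?case using const[of 0] by simp
    next
      case (Suc N)
      then have "Poly_Mapping.keys f \<noteq> {}" by (intro notI) simp
      then obtain m where m: "m \<in> Poly_Mapping.keys f" by blast
      let ?t = "Poly_Mapping.single m (Poly_Mapping.lookup f m)"
      have keys: "Poly_Mapping.keys (f - ?t) = Poly_Mapping.keys f - {m}"
        by (auto simp: in_keys_iff lookup_minus lookup_single when_def split: if_splits)
      have "f - ?t \<in> ?R"
        using Suc m by (intro Suc.hyps(1)) (auto simp: keys supported_on_def)
      moreover have "?t \<in> ?R"
        using mult[OF const monom, of m "Poly_Mapping.lookup f m"] m Suc.prems
        by (auto simp: mult_single supported_on_def)
      ultimately have "(f - ?t) + ?t \<in> ?R" by (rule add)
      then show ?case by simp
    qed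
  qed
qed

theorem corollary2p8:
  fixes A :: "int mat" and d n :: nat
  assumes "A \<in> carrier_mat d n" and "unimodular A"
  shows "normal_ring (toric_ring (cs_config A) :: 'k::field laurent set)"
proof -
  let ?R = "toric_ring (cs_config A) :: 'k laurent set"
  note A = assms(1)
  note R = toric_ring_cs_config[OF A, where ?'k = 'k]
  have const: "Poly_Mapping.single 0 a \<in> ?R" and add: "f \<in> ?R \<Longrightarrow> g \<in> ?R \<Longrightarrow> f + g \<in> ?R"
    and mult: "f \<in> ?R \<Longrightarrow> g \<in> ?R \<Longrightarrow> f * g \<in> ?R" for a f g
    using is_subalgebra_toric_ring[of "cs_config A"] unfolding is_subalgebra_def by blast+
  have uminus: "- f \<in> ?R" if "f \<in> ?R" for f
    using that unfolding R supported_on_def by simp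
  have fin: "finite {s \<in> cs_exponents A. weight_first d s \<le> weight_first d m}" for m
    using weight_first_le
    by (intro finite_subset[OF _ finite_cs_exponents_bounded[OF A, of "Poly_Mapping.lookup m d"]]) auto
  show ?thesis
    unfolding normal_ring_def
  proof (intro ballI impI)
    fix x :: "'k laurent fract"
    assume "x \<in> frac_of ?R" and int: "integral_over ((\<lambda>a. Fraction_Field.Fract a 1) ` ?R) x"
    then obtain a b where ab: "a \<in> ?R" "b \<in> ?R" "b \<noteq> 0" and x: "x = Fraction_Field.Fract a b"
      unfolding frac_of_def by blast
    have "\<exists>N. \<forall>k. \<exists>r\<in>?R. b ^ N * a ^ k = r * b ^ k"
      using const[of 0] const[of 1]
      by (intro integral_over_almost_integral[OF add mult uminus _ _ ab int[unfolded x]]) simp_all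
    then obtain N where N: "\<And>k. \<exists>r\<in>?R. b ^ N * a ^ k = r * b ^ k" by blast
    \<comment> \<open>The denominator \<open>b ^ N\<close> is itself in the ring, as the case \<open>k = 0\<close> shows.\<close>
    obtain g where g: "g \<in> ?R" "b ^ N = g" using N[of 0] by auto
    have "g \<noteq> 0" using g(2) ab(3) by auto
    have "\<exists>q\<in>supported_on (cs_exponents A). a = q * b"
      by (rule weight_first.almost_integral_divides[of "cs_exponents A" d,
            OF add_in_cs_exponents[OF A] fin cs_exponents_almost_integrally_closed[OF A assms(2)]
              ab(2)[unfolded R] ab(3) g(1)[unfolded R] \<open>g \<noteq> 0\<close> ab(1)[unfolded R]
              N[unfolded g(2) R]])
    then obtain q where q: "q \<in> ?R" "a = q * b" unfolding R by blast
    have "x = Fraction_Field.Fract q 1" using ab(3) by (simp add: x q(2) eq_fract)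
    then show "x \<in> (\<lambda>a. Fraction_Field.Fract a 1) ` ?R" using q(1) by blast
  qed
qed

end
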